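(* Let $\mu$ be a Borel probability measure on $2^\omega$. Let $R\subseteq 2^\omega\times\omega^\omega$ with $\{x:\exists y\ (x,y)\in R\}=2^\omega$, and suppose the unfolded measure game $G_{\text{unfolded}}(0,R)$ is determined. Then for every $\epsilon>0$ there exist a closed set $A\subseteq2^\omega$ with $\mu(A)>1-\epsilon$ and a continuous function $f:A\to\omega^\omega$ such that $(x,f(x))\in R$ for all $x\in A$.
   Context: $2^\omega$ is the space of infinite binary sequences, $\omega^\omega$ the Baire space; for $t\in2^{<\omega}$, $N_t=\{x\in2^\omega:t\subseteq x\}$, $t^\frown i$ is $t$ extended by $i$. The unfolded measure game $G_{\text{unfolded}}(s,F)$ for $F\subseteq2^\omega\times\omega^\omega$ and $s\in[0,1)$: in round $n$, after II has played $t=x_0\dots x_{n-1}$, I plays $(m_{t^\frown0},m_{t^\frown1})$, and II plays $x_n$, optionally together with a natural number; the natural numbers played by II, in order, are $y_0,y_1,\dots$. Put $m_\emptyset=m_0+m_1$. Rules for I: all $m_t$ rational with $m_t\ge0$; $m_0+m_1>s$; $\mu(N_t)>0\Rightarrow m_t<\mu(N_t)$; $m_{t^\frown0}+m_{t^\frown1}=m_t$. Rules for II: $x_n\in\{0,1\}$; $m_{x_0\dots x_n}\neq0$; and II plays infinitely many $y$-digits. If both follow the rules, II wins iff $(x,y)\in F$ where $x=(x_n)$, $y=(y_i)$; otherwise the rule-violator loses. Determined means one of the players has a winning strategy.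
   Formalization: The rules for I are supplemented by: if μ(N_t)=0 then m_t=0 (vacuous when μ has full support); without this, I could confine II to a null basic set and win there, and the statement fails, e.g. for a relation coding a Bernstein set on the support of μ. *)

theory Defs
  imports "HOL-Probability.Probability" "HOL-Library.Infinite_Set"
begin

text \<open>The Cantor space is \<^typ>\<open>nat \<Rightarrow> bool\<close> and the Baire space is \<^typ>\<open>nat \<Rightarrow> nat\<close>, both with
  the library's product topology over a discrete factor; the digit 1 is \<^const>\<open>True\<close>.\<close>

definition cyl :: "bool list \<Rightarrow> (nat \<Rightarrow> bool) set" where
  "cyl t = {x. \<forall>i<length t. x i = t ! i}"

text \<open>A round consists of I's pair of rationals and of II's bit with an optional natural number.\<close>

type_synonym I_move = "rat \<times> rat"
type_synonym II_move = "bool \<times> nat option"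
type_synonym round = "I_move \<times> II_move"
type_synonym play = "nat \<Rightarrow> round"

definition bits :: "play \<Rightarrow> nat \<Rightarrow> bool" where
  "bits p n = fst (snd (p n))"

definition bits_before :: "play \<Rightarrow> nat \<Rightarrow> bool list" where
  "bits_before p n = map (bits p) [0..<n]"

definition digit_rounds :: "play \<Rightarrow> nat set" where
  "digit_rounds p = {n. snd (snd (p n)) \<noteq> None}"

text \<open>The sequence y; meaningful only if \<^term>\<open>digit_rounds p\<close> is infinite.\<close>

definition digits :: "play \<Rightarrow> nat \<Rightarrow> nat" where
  "digits p i = the (snd (snd (p (enumerate (digit_rounds p) i))))"

text \<open>\<^term>\<open>mass p n\<close> is the number assigned by I in the play p to the sequence
  \<^term>\<open>bits_before p n\<close>.\<close>

fun mass :: "play \<Rightarrow> nat \<Rightarrow> rat" where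
  "mass p 0 = fst (fst (p 0)) + snd (fst (p 0))"
| "mass p (Suc n) = (if bits p n then snd (fst (p n)) else fst (fst (p n)))"

text \<open>The last clause says that null basic sets get no mass, so that in all cases m is at most the
  measure of the basic set. Without it I could confine II to a null basic set, on which the relation
  F is arbitrary as far as the measure is concerned.\<close>

definition admissible_mass :: "(nat \<Rightarrow> bool) measure \<Rightarrow> bool list \<Rightarrow> rat \<Rightarrow> bool" where
  "admissible_mass \<mu> t m \<longleftrightarrow>
     m \<ge> 0 \<and>
     (measure \<mu> (cyl t) > 0 \<longrightarrow> of_rat m < measure \<mu> (cyl t)) \<and>
     (measure \<mu> (cyl t) = 0 \<longrightarrow> m = 0)"

definition I_legal :: "(nat \<Rightarrow> bool) measure \<Rightarrow> real \<Rightarrow> play \<Rightarrow> nat \<Rightarrow> bool" where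
  "I_legal \<mu> s p n \<longleftrightarrow>
     (let t = bits_before p n; m0 = fst (fst (p n)); m1 = snd (fst (p n)) in
        (n = 0 \<longrightarrow> of_rat (m0 + m1) > s) \<and>
        m0 + m1 = mass p n \<and>
        admissible_mass \<mu> t (m0 + m1) \<and>
        admissible_mass \<mu> (t @ [False]) m0 \<and>
        admissible_mass \<mu> (t @ [True]) m1)"

definition II_legal :: "play \<Rightarrow> nat \<Rightarrow> bool" where
  "II_legal p n \<longleftrightarrow> mass p (Suc n) \<noteq> 0"

text \<open>The first violator of a rule loses; in each round I moves before II. The rule that II plays
  infinitely many digits can only be violated at the end of the play.\<close>

definition II_wins_play ::
    "(nat \<Rightarrow> bool) measure \<Rightarrow> real \<Rightarrow> ((nat \<Rightarrow> bool) \<times> (nat \<Rightarrow> nat)) set \<Rightarrow> play \<Rightarrow> bool" where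
  "II_wins_play \<mu> s F p \<longleftrightarrow>
     (\<exists>n. \<not> I_legal \<mu> s p n \<and> (\<forall>k<n. I_legal \<mu> s p k \<and> II_legal p k)) \<or>
     ((\<forall>n. I_legal \<mu> s p n \<and> II_legal p n) \<and> infinite (digit_rounds p) \<and>
      (bits p, digits p) \<in> F)"

type_synonym I_strategy = "round list \<Rightarrow> I_move"
type_synonym II_strategy = "round list \<Rightarrow> I_move \<Rightarrow> II_move"

definition follows_I :: "I_strategy \<Rightarrow> play \<Rightarrow> bool" where
  "follows_I \<sigma> p \<longleftrightarrow> (\<forall>n. fst (p n) = \<sigma> (map p [0..<n]))"

definition follows_II :: "II_strategy \<Rightarrow> play \<Rightarrow> bool" where
  "follows_II \<tau> p \<longleftrightarrow> (\<forall>n. snd (p n) = \<tau> (map p [0..<n]) (fst (p n)))"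

definition unfolded_game_determined ::
    "(nat \<Rightarrow> bool) measure \<Rightarrow> real \<Rightarrow> ((nat \<Rightarrow> bool) \<times> (nat \<Rightarrow> nat)) set \<Rightarrow> bool" where
  "unfolded_game_determined \<mu> s F \<longleftrightarrow>
     (\<exists>\<sigma>. \<forall>p. follows_I \<sigma> p \<longrightarrow> \<not> II_wins_play \<mu> s F p) \<or>
     (\<exists>\<tau>. \<forall>p. follows_II \<tau> p \<longrightarrow> II_wins_play \<mu> s F p)"

end

theory Submission
  imports Defs
begin

text \<open>Player I has no winning strategy. Against a fixed strategy of I, every history \<open>w\<close> of moves of II
  yields a set \<open>D(w)\<close> of positive measure of points \<open>x\<close> along which II may continue without playing
  digits while I's mass stays above a fixed proportion of the measure of the cylinders around \<open>x\<close>. By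
  a density argument, almost every \<open>x\<close> in \<open>D(w)\<close> also lies in \<open>D(w')\<close> for some extension \<open>w'\<close> of \<open>w\<close>
  that ends with a prescribed digit. There are only countably many histories, so for almost every \<open>x\<close>
  in \<open>D([])\<close> II can play \<open>x\<close> together with every \<open>y\<close>, in particular with one such that \<open>(x, y)\<close> is
  in \<open>R\<close>.

  Hence II has a winning strategy \<open>\<tau>\<close>. Let I start with a small total mass \<open>m\<close>. The slack of a position
  is the measure of its cylinder minus its mass. By varying I's move one can reach from each position
  at most one successor for each bit, losing arbitrarily little of the total slack. This gives a tree
  with at most one position for each binary string, whose branches form a closed set of measure
  nearly \<open>1 - m\<close>, and the digits that \<open>\<tau>\<close> plays along a branch depend continuously on it.\<close>

section \<open>Cylinders and lists of fixed length\<close>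

lemma mem_cyl_iff: "x \<in> cyl t \<longleftrightarrow> map x [0..<length t] = t"
  unfolding cyl_def list_eq_iff_nth_eq by simp

lemma mem_cyl_append_iff:
  "x \<in> cyl (t @ s) \<longleftrightarrow> x \<in> cyl t \<and> map x [length t..<length t + length s] = s"
  unfolding mem_cyl_iff length_append upt_add_eq_append[OF le0] map_append
  by (rule append_eq_append_conv) simp

lemma map_upt_mem_cyl: "x \<in> cyl (map x [0..<n])"
  by (simp add: cyl_def)

lemma cyl_Nil [simp]: "cyl [] = UNIV"
  by (simp add: cyl_def)

lemma cyl_split: "cyl t = cyl (t @ [False]) \<union> cyl (t @ [True])"
  by (simp only: set_eq_iff Un_iff mem_cyl_append_iff) auto

lemma cyl_append_disjoint:
  assumes "length s = length s'" "s \<noteq> s'"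
  shows "cyl (t @ s) \<inter> cyl (t @ s') = {}"
proof (rule ccontr)
  assume "cyl (t @ s) \<inter> cyl (t @ s') \<noteq> {}"
  then obtain x where x: "x \<in> cyl (t @ s)" "x \<in> cyl (t @ s')"
    by blast
  have "map x [length t..<length t + length s] = s"
    using x(1) mem_cyl_append_iff by blast
  moreover have "map x [length t..<length t + length s'] = s'"
    using x(2) mem_cyl_append_iff by blast
  ultimately show False
    using assms by metis
qed

lemma cyl_append_subset: "cyl (t @ s) \<subseteq> cyl t"
  using mem_cyl_append_iff by blast

lemma clopen_coordinate:
  fixes b :: bool
  shows "open {x :: nat \<Rightarrow> bool. x i = b}" "closed {x :: nat \<Rightarrow> bool. x i = b}"
proof -
  have *: "{x :: nat \<Rightarrow> bool. x i = c} = (\<lambda>x. x i) -` {c}" for c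
    by auto
  have o: "open {x :: nat \<Rightarrow> bool. x i = c}" for c
    unfolding * by (intro open_vimage discrete_topology_class.open_discrete continuous_on_product_coordinates)
  then show "open {x :: nat \<Rightarrow> bool. x i = b}" .
  have "- {x :: nat \<Rightarrow> bool. x i = b} = {x. x i = (\<not> b)}"
    by auto
  then show "closed {x :: nat \<Rightarrow> bool. x i = b}"
    using o[of "\<not> b"] by (simp add: closed_def)
qed

lemma open_cyl: "open (cyl t)" and closed_cyl: "closed (cyl t)"
proof -
  have *: "cyl t = (\<Inter>i<length t. {x. x i = t ! i})"
    by (auto simp: cyl_def)
  show "open (cyl t)"
    unfolding * by (intro open_INT) (auto simp: clopen_coordinate)
  show "closed (cyl t)"
    unfolding * by (intro closed_INT) (auto simp: clopen_coordinate)
qed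

text \<open>A basic open set of the product restricts only finitely many coordinates, and a long
  enough initial segment of \<open>x\<close> fixes them all.\<close>

lemma open_contains_cyl:
  fixes U :: "(nat \<Rightarrow> bool) set"
  assumes "open U" "x \<in> U"
  obtains n where "\<And>m. n \<le> m \<Longrightarrow> cyl (map x [0..<m]) \<subseteq> U"
proof -
  have "openin (product_topology (\<lambda>i. euclidean) UNIV) U"
    using assms(1) by (simp add: open_fun_def)
  from product_topology_open_contains_basis[OF this assms(2)]
  obtain X where X: "x \<in> (\<Pi>\<^sub>E i\<in>UNIV. X i)" "finite {i. X i \<noteq> UNIV}" "(\<Pi>\<^sub>E i\<in>UNIV. X i) \<subseteq> U"
    by auto
  obtain n where n: "\<And>i. X i \<noteq> UNIV \<Longrightarrow> i < n"
    using X(2) unfolding finite_nat_set_iff_bounded by auto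
  have "cyl (map x [0..<m]) \<subseteq> U" if "n \<le> m" for m
  proof
    fix z assume z: "z \<in> cyl (map x [0..<m])"
    have "z i \<in> X i" for i
    proof (cases "X i = UNIV")
      case False
      then have "i < m" using n that by force
      then have "z i = x i" using z by (simp add: cyl_def)
      then show ?thesis using X(1) by (auto simp: PiE_iff)
    qed simp
    then show "z \<in> U" using X(3) by (auto simp: PiE_iff)
  qed
  then show thesis by (rule that)
qed

lemma finite_lists_of_length: "finite {s :: bool list. length s = n}"
  using finite_lists_length_eq[of "UNIV :: bool set" n] by simp

lemma sum_lists_Suc:
  fixes g :: "bool list \<Rightarrow> real"
  shows "(\<Sum>s | length s = Suc n. g s) = (\<Sum>s | length s = n. g (s @ [False]) + g (s @ [True]))"
proof -
  let ?h = "\<lambda>(s :: bool list, b). s @ [b]"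
  have img: "{s. length s = Suc n} = ?h ` ({s. length s = n} \<times> UNIV)"
  proof
    show "{s. length s = Suc n} \<subseteq> ?h ` ({s. length s = n} \<times> UNIV)"
    proof
      fix s :: "bool list" assume "s \<in> {s. length s = Suc n}"
      then have "s = ?h (butlast s, last s)" "length (butlast s) = n"
        by (auto simp: length_Suc_conv)
      then show "s \<in> ?h ` ({s. length s = n} \<times> UNIV)"
        by (metis (mono_tags, lifting) image_eqI mem_Collect_eq mem_Sigma_iff UNIV_I)
    qed
  qed auto
  have "inj_on ?h ({s. length s = n} \<times> UNIV)"
    by (auto simp: inj_on_def)
  then have "(\<Sum>s | length s = Suc n. g s) = (\<Sum>(s, b) \<in> {s. length s = n} \<times> UNIV. g (s @ [b]))"
    unfolding img by (subst sum.reindex) (auto simp: case_prod_unfold)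
  also have "\<dots> = (\<Sum>s | length s = n. \<Sum>b\<in>UNIV. g (s @ [b]))"
    by (subst sum.cartesian_product) simp
  finally show ?thesis
    by (simp add: UNIV_bool)
qed

section \<open>Borel probability measures on the Cantor space\<close>

text \<open>The library proves regularity of Borel measures for complete second countable metric spaces.\<close>

instantiation bool :: metric_space
begin

definition dist_bool :: "bool \<Rightarrow> bool \<Rightarrow> real" where
  "dist_bool a b = (if a = b then 0 else 1)"

definition uniformity_bool :: "(bool \<times> bool) filter" where
  "uniformity_bool = (INF e\<in>{0 <..}. principal {(x, y). dist x y < e})"

instance
proof
  show "uniformity = (INF e\<in>{0 <..}. principal {(x :: bool, y). dist x y < e})"
    by (rule uniformity_bool_def)
  fix U :: "bool set"
  have "eventually (\<lambda>(a, b). a = b) (uniformity :: (bool \<times> bool) filter)"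
    unfolding uniformity_bool_def
    by (rule eventually_INF1[of 1]) (auto simp: eventually_principal dist_bool_def split: if_splits)
  then have "\<forall>x\<in>U. eventually (\<lambda>(x', y). x' = x \<longrightarrow> y \<in> U) uniformity"
    by (auto elim!: eventually_mono)
  then show "open U \<longleftrightarrow> (\<forall>x\<in>U. eventually (\<lambda>(x', y). x' = x \<longrightarrow> y \<in> U) uniformity)"
    by (simp add: discrete_topology_class.open_discrete)
qed (auto simp: dist_bool_def)

end

instance bool :: complete_space
proof
  fix X :: "nat \<Rightarrow> bool"
  assume "Cauchy X"
  then obtain N where "\<And>m n. m \<ge> N \<Longrightarrow> n \<ge> N \<Longrightarrow> dist (X m) (X n) < 1"
    unfolding Cauchy_def by (meson zero_less_one)
  then have "X n = X N" if "n \<ge> N" for n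
    using that by (force simp: dist_bool_def split: if_splits)
  then have "X \<longlonglongrightarrow> X N"
    by (intro tendsto_eventually eventually_sequentiallyI)
  then show "convergent X"
    by (rule convergentI)
qed

instance bool :: second_countable_topology
proof
  have "open = generate_topology (UNIV :: bool set set)"
    by (auto simp: fun_eq_iff discrete_topology_class.open_discrete intro: generate_topology.Basis)
  then show "\<exists>B :: bool set set. countable B \<and> open = generate_topology B"
    by (intro exI[of _ UNIV]) (simp add: countable_finite)
qed

locale cantor_prob = prob_space \<mu> for \<mu> :: "(nat \<Rightarrow> bool) measure" +
  assumes sets_eq_borel: "sets \<mu> = sets borel"
begin

lemma space_eq_UNIV: "space \<mu> = UNIV"
  using sets_eq_imp_space_eq[OF sets_eq_borel] by simp

lemma sets_closed: "closed A \<Longrightarrow> A \<in> sets \<mu>"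
  by (simp add: sets_eq_borel)

lemma sets_cyl: "cyl t \<in> sets \<mu>"
  by (intro sets_closed closed_cyl)

lemma prob_UNIV: "prob UNIV = 1"
  using prob_space space_eq_UNIV by simp

lemma prob_cyl_split: "prob (cyl t) = prob (cyl (t @ [False])) + prob (cyl (t @ [True]))"
proof -
  have "cyl (t @ [False]) \<inter> cyl (t @ [True]) = {}"
    by (rule cyl_append_disjoint) simp_all
  from finite_measure_Union[OF sets_cyl sets_cyl this] show ?thesis
    by (simp only: cyl_split[of t])
qed

lemma prob_Int_Union_cyl:
  assumes "finite J" "\<And>s. s \<in> J \<Longrightarrow> length s = n" "C \<in> sets \<mu>"
  shows "prob (C \<inter> (\<Union>s\<in>J. cyl (t @ s))) = (\<Sum>s\<in>J. prob (C \<inter> cyl (t @ s)))"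
proof -
  have "disjoint_family_on (\<lambda>s. C \<inter> cyl (t @ s)) J"
    unfolding disjoint_family_on_def using cyl_append_disjoint[of _ _ t] assms(2) by blast
  then have "prob (\<Union>s\<in>J. C \<inter> cyl (t @ s)) = (\<Sum>s\<in>J. prob (C \<inter> cyl (t @ s)))"
    using assms sets_cyl by (intro finite_measure_finite_Union) auto
  then show ?thesis
    unfolding Int_UN_distrib .
qed

text \<open>\<open>\<phi>\<close> is a potential on the binary tree: its sum over a level never
  decreases, and at level \<open>n\<close> it is bounded by the measure of the clopen set
  \<open>S n\<close> of points still in the tree. These sets decrease to \<open>A\<close>. Both
  halves of the proof use this, with different potentials.\<close>

lemma prob_branches_ge:
  fixes P :: "bool list \<Rightarrow> bool" and \<phi> :: "bool list \<Rightarrow> real" and t :: "bool list"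
  defines "A \<equiv> {x \<in> cyl t. \<forall>n. P (map x [length t..<length t + n])}"
  assumes prefix: "\<And>s b. P (s @ [b]) \<Longrightarrow> P s"
    and split: "\<And>s. \<phi> s \<le> \<phi> (s @ [False]) + \<phi> (s @ [True])"
    and le: "\<And>s. P s \<Longrightarrow> \<phi> s \<le> prob (cyl (t @ s))"
    and out: "\<And>s. \<not> P s \<Longrightarrow> \<phi> s \<le> 0"
  shows "closed A" "\<phi> [] \<le> prob A"
proof -
  define S where "S n = (\<Union>s\<in>{s. length s = n \<and> P s}. cyl (t @ s))" for n
  have fin: "finite {s. length s = n \<and> P s}" for n
    by (rule finite_subset[OF _ finite_lists_of_length[of n]]) auto
  have S_iff: "x \<in> S n \<longleftrightarrow> x \<in> cyl t \<and> P (map x [length t..<length t + n])" for x n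
    by (auto simp: S_def mem_cyl_append_iff)
  have A_eq: "A = (\<Inter>n. S n)"
    by (auto simp: A_def S_iff)
  have closed_S: "closed (S n)" for n
    unfolding S_def by (intro closed_UN fin ballI closed_cyl)
  then show "closed A"
    unfolding A_eq by (intro closed_INT) auto
  have dec: "decseq S"
    using prefix by (intro decseq_SucI) (auto simp: S_iff)
  have level: "\<phi> [] \<le> (\<Sum>s | length s = n. \<phi> s)" for n
  proof (induction n)
    case (Suc n)
    have "(\<Sum>s | length s = n. \<phi> s) \<le> (\<Sum>s | length s = Suc n. \<phi> s)"
      unfolding sum_lists_Suc by (intro sum_mono split)
    with Suc show ?case by simp
  qed simp
  have "\<phi> [] \<le> prob (S n)" for n
  proof -
    have "\<phi> [] \<le> (\<Sum>s | length s = n. \<phi> s)"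
      by (rule level)
    also have "\<dots> \<le> (\<Sum>s | length s = n. if P s then prob (cyl (t @ s)) else 0)"
      by (intro sum_mono) (simp add: le out)
    also have "\<dots> = (\<Sum>s | length s = n \<and> P s. prob (cyl (t @ s)))"
      by (subst sum.inter_filter[symmetric]) (auto simp: finite_lists_of_length)
    also have "\<dots> = prob (S n)"
      using prob_Int_Union_cyl[OF fin, of n n UNIV t] sets_closed[OF closed_UNIV]
      by (simp add: S_def)
    finally show ?thesis .
  qed
  moreover have "(\<lambda>n. prob (S n)) \<longlonglongrightarrow> prob (\<Inter>n. S n)"
    using dec closed_S by (intro finite_Lim_measure_decseq) (auto intro: sets_closed)
  ultimately show "\<phi> [] \<le> prob A"
    unfolding A_eq by (intro LIMSEQ_le_const) auto
qed

text \<open>A weak form of the Lebesgue density theorem: outer regularity suffices, since an open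
  superset is exhausted by its cylinders of length \<open>n\<close>.\<close>

lemma prob_eq_0_of_density_le:
  assumes C: "C \<in> sets \<mu>" and q: "0 \<le> q" "q < 1"
    and dens: "\<And>x n. x \<in> C \<Longrightarrow> n0 \<le> n \<Longrightarrow>
      prob (C \<inter> cyl (map x [0..<n])) \<le> q * prob (cyl (map x [0..<n]))"
  shows "prob C = 0"
proof -
  have bound: "prob C \<le> q * prob U" if "open U" "C \<subseteq> U" for U
  proof -
    define J where "J n = {s. length s = n \<and> cyl s \<subseteq> U}" for n
    define V where "V n = (\<Union>s\<in>J n. cyl s)" for n
    have fin: "finite (J n)" for n
      unfolding J_def by (rule finite_subset[OF _ finite_lists_of_length[of n]]) (rule Collect_mono, simp)
    have V_iff: "x \<in> V n \<longleftrightarrow> cyl (map x [0..<n]) \<subseteq> U" for x n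
    proof
      assume "x \<in> V n"
      then obtain s where "length s = n" "cyl s \<subseteq> U" "x \<in> cyl s"
        by (auto simp: V_def J_def)
      then show "cyl (map x [0..<n]) \<subseteq> U"
        using mem_cyl_iff[of x s] by simp
    next
      assume "cyl (map x [0..<n]) \<subseteq> U"
      then have "map x [0..<n] \<in> J n"
        by (simp add: J_def)
      then show "x \<in> V n"
        unfolding V_def using map_upt_mem_cyl by blast
    qed
    have "incseq V"
    proof (rule incseq_SucI)
      show "V n \<subseteq> V (Suc n)" for n
      proof
        fix x assume "x \<in> V n"
        moreover have "cyl (map x [0..<Suc n]) \<subseteq> cyl (map x [0..<n])"
          using cyl_append_subset[of "map x [0..<n]" "[x n]"] by simp
        ultimately show "x \<in> V (Suc n)"
          unfolding V_iff by (rule subset_trans[rotated])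
      qed
    qed
    moreover have "(\<Union>n. V n) = U"
    proof
      show "(\<Union>n. V n) \<subseteq> U" by (auto simp: V_def J_def)
      show "U \<subseteq> (\<Union>n. V n)"
      proof
        fix x assume "x \<in> U"
        then obtain n where "cyl (map x [0..<n]) \<subseteq> U"
          using open_contains_cyl[OF \<open>open U\<close>] by (metis order_refl)
        then show "x \<in> (\<Union>n. V n)" using V_iff by blast
      qed
    qed
    moreover have VS: "V n \<in> sets \<mu>" for n
      unfolding V_def by (intro sets.finite_UN fin sets_cyl)
    moreover from \<open>incseq V\<close> have "incseq (\<lambda>n. C \<inter> V n)"
      unfolding incseq_def by blast
    moreover have "(\<Union>n. C \<inter> V n) = C \<inter> (\<Union>n. V n)"
      by blast
    ultimately have lim: "(\<lambda>n. prob (C \<inter> V n)) \<longlonglongrightarrow> prob (C \<inter> U)" "(\<lambda>n. prob (V n)) \<longlonglongrightarrow> prob U"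
      using finite_Lim_measure_incseq[of "\<lambda>n. C \<inter> V n"] finite_Lim_measure_incseq[of V] C
      by auto
    have "prob (C \<inter> V n) \<le> q * prob (V n)" if "n0 \<le> n" for n
    proof -
      have len: "length s = n" if "s \<in> J n" for s n
        using that by (simp add: J_def)
      have "prob (C \<inter> V n) = (\<Sum>s\<in>J n. prob (C \<inter> cyl s))"
        unfolding V_def using prob_Int_Union_cyl[OF fin len C, where t = "[]"] by simp
      also have "\<dots> \<le> (\<Sum>s\<in>J n. q * prob (cyl s))"
      proof (intro sum_mono)
        fix s assume "s \<in> J n"
        \<comment> \<open>A cylinder that meets \<open>C\<close> is the one around some point of
          \<open>C\<close>, where \<open>dens\<close> applies.\<close>
        show "prob (C \<inter> cyl s) \<le> q * prob (cyl s)"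
        proof (cases "C \<inter> cyl s = {}")
          case False
          then obtain x where "x \<in> C" "map x [0..<n] = s"
            using len[OF \<open>s \<in> J n\<close>] mem_cyl_iff[of _ s] by blast
          then show ?thesis using dens that by blast
        qed (use q in simp)
      qed
      also have "\<dots> = q * prob (V n)"
        unfolding V_def sum_distrib_left[symmetric]
        using prob_Int_Union_cyl[OF fin len sets_closed[OF closed_UNIV], where t = "[]"] by simp
      finally show ?thesis .
    qed
    then have "prob (C \<inter> U) \<le> q * prob U"
      by (intro LIMSEQ_le[OF lim(1) tendsto_mult_left[OF lim(2)]]) blast
    then show ?thesis using \<open>C \<subseteq> U\<close> by (simp add: Int_absorb2)
  qed
  \<comment> \<open>Outer regularity gives an open \<open>U\<close> of measure at most
    \<open>prob C + e\<close>. Since \<open>e\<close> is arbitrary and \<open>q < 1\<close>, this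
    forces measure 0.\<close>
  have "prob C \<le> q * prob C + e" if "0 < e" for e
  proof -
    have "emeasure \<mu> C < ennreal (prob C + e)"
      using that by (simp add: emeasure_eq_measure ennreal_less_iff)
    then obtain U where U: "C \<subseteq> U" "open U" "emeasure \<mu> U < ennreal (prob C + e)"
      using outer_regular[OF sets_eq_borel, of C] C sets_eq_borel emeasure_finite
      by (auto simp: INF_less_iff)
    then have "prob U \<le> prob C + e"
      using that by (simp add: emeasure_eq_measure ennreal_less_iff del: ennreal_plus)
    then have "prob C \<le> q * (prob C + e)"
      using bound[OF U(2,1)] q(1) by (meson mult_left_mono order_trans)
    also have "\<dots> \<le> q * prob C + e"
      using q that by (simp add: distrib_left mult_left_le_one_le)
    finally show ?thesis .
  qed
  then have "prob C \<le> q * prob C"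
    by (rule field_le_epsilon)
  then have "(1 - q) * prob C \<le> 0"
    by (simp add: algebra_simps)
  then show ?thesis
    using q(2) measure_nonneg[of \<mu> C] by (simp add: mult_le_0_iff)
qed

end

section \<open>Enumerations of sets of natural numbers\<close>

lemma card_less_enumerate:
  fixes S :: "nat set"
  assumes "infinite S"
  shows "card {s \<in> S. s < enumerate S i} = i"
proof -
  have "{s \<in> S. s < enumerate S i} = enumerate S ` {..<i}"
    using assms enumerate_Ex[OF assms] enumerate_in_set[OF assms]
    by auto (metis enumerate_mono_iff imageI lessThan_iff)
  moreover have "inj_on (enumerate S) {..<i}"
    using inj_enumerate[OF assms] by (rule inj_on_subset) simp
  ultimately show ?thesis
    by (simp add: card_image)
qed

text \<open>The index of \<open>e\<close> is the number of smaller elements, so it depends only on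
  the part of \<open>S\<close> below \<open>e\<close>. Continuity of the digits rests on
  this.\<close>

lemma enumerate_eqI:
  fixes S :: "nat set"
  assumes "infinite S" "e \<in> S" "card {s \<in> S. s < e} = i"
  shows "enumerate S i = e"
  using enumerate_Ex[OF assms(1,2)] card_less_enumerate[OF assms(1)] assms(3) by auto

lemma enumerate_range_strict_mono:
  fixes e :: "nat \<Rightarrow> nat"
  assumes "strict_mono e"
  shows "enumerate (range e) i = e i"
proof (rule enumerate_eqI)
  have inj: "inj e"
    using assms by (rule strict_mono_imp_inj_on)
  then show "infinite (range e)"
    by (simp add: finite_image_iff)
  have "{s \<in> range e. s < e i} = e ` {..<i}"
    using strict_mono_less[OF assms] by auto
  moreover have "inj_on e {..<i}"
    using inj by (rule inj_on_subset) simp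
  ultimately show "card {s \<in> range e. s < e i} = i"
    by (simp add: card_image)
qed simp

section \<open>Player I has no winning strategy\<close>

definition no_digits :: "II_move list \<Rightarrow> bool list \<Rightarrow> II_move list" where
  "no_digits w s = w @ map (\<lambda>b. (b, None)) s"

lemma no_digits_Nil [simp]: "no_digits w [] = w"
  and no_digits_snoc: "no_digits w (s @ [b]) = no_digits w s @ [(b, None)]"
  and length_no_digits [simp]: "length (no_digits w s) = length w + length s"
  and map_fst_no_digits [simp]: "map fst (no_digits w s) = map fst w @ s"
  by (simp_all add: no_digits_def comp_def)

text \<open>\<open>M w\<close> is the mass that a fixed strategy of I gives to the bits of the history \<open>w\<close> of II's
  moves, and \<open>L w\<close> says that II has obeyed the rules in \<open>w\<close>.\<close>

locale mass_assignment = cantor_prob +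
  fixes M :: "II_move list \<Rightarrow> real" and L :: "II_move list \<Rightarrow> bool"
  assumes L_Nil: "L []"
    and L_snoc: "L (w @ [v]) \<longleftrightarrow> L w \<and> M (w @ [v]) \<noteq> 0"
    and M_pos: "L w \<Longrightarrow> 0 < M w"
    and M_le: "L w \<Longrightarrow> M w \<le> prob (cyl (map fst w))"
    and M_split: "L w \<Longrightarrow> M w = M (w @ [(False, k)]) + M (w @ [(True, l)])"
begin

lemma L_appendD: "L (w @ z) \<Longrightarrow> L w"
proof (induction z rule: rev_induct)
  case (snoc v z)
  then have "L ((w @ z) @ [v])" by simp
  then show ?case using snoc.IH L_snoc by blast
qed simp

text \<open>I names both masses before II answers, so the digit in the answer cannot affect them.
  The independent \<open>k\<close> and \<open>l\<close> in \<open>M_split\<close> encode this;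
  comparing instances gives the claim.\<close>

lemma M_digit_irrelevant:
  assumes "L w" shows "M (w @ [(b, k)]) = M (w @ [(b, None)])"
  using M_split[OF assms, of k None] M_split[OF assms, of None None] M_split[OF assms, of None k]
  by (cases b) auto

text \<open>Half the density of I's mass in the cylinder. The factor 2 leaves half of
  \<open>M w\<close> as surplus over the threshold in \<open>branches_large\<close>.\<close>

definition ratio :: "II_move list \<Rightarrow> real" where
  "ratio w = M w / (2 * prob (cyl (map fst w)))"

text \<open>Requiring the bound at all prefixes makes the dense strings a tree. The threshold is
  fixed at \<open>w\<close>, so the proportion does not deteriorate along a branch.\<close>

definition dense :: "II_move list \<Rightarrow> bool list \<Rightarrow> bool" where
  "dense w s \<longleftrightarrow>
     (\<forall>k\<le>length s. ratio w * prob (cyl (map fst w @ take k s)) < M (no_digits w (take k s)))"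

text \<open>The set \<open>D(w)\<close> of the opening outline.\<close>

definition branches :: "II_move list \<Rightarrow> (nat \<Rightarrow> bool) set" where
  "branches w = {x \<in> cyl (map fst w). \<forall>n. dense w (map x [length w..<length w + n])}"

lemma prob_cyl_pos: "L w \<Longrightarrow> 0 < prob (cyl (map fst w))"
  using M_pos M_le less_le_trans by blast

lemma ratio_bounds: "L w \<Longrightarrow> 0 < ratio w \<and> ratio w \<le> 1 / 2"
  using M_pos[of w] M_le[of w] prob_cyl_pos[of w] by (simp add: ratio_def field_simps)

lemma dense_snoc:
  "dense w (s @ [b]) \<longleftrightarrow> dense w s \<and>
     ratio w * prob (cyl (map fst w @ s @ [b])) < M (no_digits w (s @ [b]))"
proof -
  have *: "(\<forall>k\<le>Suc n. Q k) \<longleftrightarrow> (\<forall>k\<le>n. Q k) \<and> Q (Suc n)" for Q n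
    using le_Suc_eq by auto
  show ?thesis
    by (simp add: dense_def *)
qed

lemma dense_Nil: "L w \<Longrightarrow> dense w []"
  using M_pos[of w] prob_cyl_pos[of w] by (simp add: dense_def ratio_def)

lemma dense_imp_L:
  assumes "L w" shows "dense w s \<Longrightarrow> L (no_digits w s)"
proof (induction s rule: rev_induct)
  case (snoc b s)
  then have "dense w s" "ratio w * prob (cyl (map fst w @ s @ [b])) < M (no_digits w (s @ [b]))"
    by (simp_all add: dense_snoc)
  moreover have "0 \<le> ratio w * prob (cyl (map fst w @ s @ [b]))"
    using ratio_bounds[OF assms] by simp
  ultimately have "L (no_digits w s)" "M (no_digits w (s @ [b])) \<noteq> 0"
    using snoc.IH by auto
  then show ?case
    by (simp add: no_digits_snoc L_snoc)
qed (use assms in simp)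

lemma dense_imp_mass:
  assumes "L w" "dense w s"
  shows "ratio w * prob (cyl (map fst w @ s)) < M (no_digits w s)"
  using assms(2) by (auto simp: dense_def dest: spec[of _ "length s"])

text \<open>\<open>prob_branches_ge\<close> is applied to the surplus of the mass over
  \<open>ratio w\<close> times the measure of the cylinder. Mass and measure both split additively,
  and the surplus at the root is \<open>M w - M w / 2\<close>.\<close>

lemma branches_large:
  assumes "L w"
  shows "closed (branches w)" "M w / 2 \<le> prob (branches w)"
proof -
  let ?t = "map fst w"
  define \<phi> where "\<phi> s = (if dense w s then M (no_digits w s) - ratio w * prob (cyl (?t @ s)) else 0)"
    for s
  have split: "\<phi> s \<le> \<phi> (s @ [False]) + \<phi> (s @ [True])" for s
  proof (cases "dense w s")
    case True
    \<comment> \<open>A child outside the tree has surplus at most 0, so counting it as 0 cannot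
      lower the sum.\<close>
    have ge: "M (no_digits w (s @ [b])) - ratio w * prob (cyl (?t @ s @ [b])) \<le> \<phi> (s @ [b])" for b
      using True by (auto simp: \<phi>_def dense_snoc)
    have "M (no_digits w s) = M (no_digits w (s @ [False])) + M (no_digits w (s @ [True]))"
      unfolding no_digits_snoc by (rule M_split[OF dense_imp_L[OF assms True]])
    moreover have "prob (cyl (?t @ s)) = prob (cyl (?t @ s @ [False])) + prob (cyl (?t @ s @ [True]))"
      using prob_cyl_split[of "?t @ s"] by simp
    ultimately show ?thesis
      using ge[of False] ge[of True] True by (simp add: \<phi>_def distrib_left)
  qed (simp add: \<phi>_def dense_snoc)
  have le: "\<phi> s \<le> prob (cyl (?t @ s))" if "dense w s" for s
  proof -
    have "M (no_digits w s) \<le> prob (cyl (?t @ s))"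
      using M_le[OF dense_imp_L[OF assms that]] by simp
    moreover have "0 \<le> ratio w * prob (cyl (?t @ s))"
      using ratio_bounds[OF assms] by simp
    ultimately show ?thesis
      by (simp add: \<phi>_def)
  qed
  have *: "branches w = {x \<in> cyl ?t. \<forall>n. dense w (map x [length ?t..<length ?t + n])}"
    by (simp add: branches_def)
  have "dense w s" if "dense w (s @ [b])" for s b
    using that by (simp add: dense_snoc)
  moreover have "\<phi> s \<le> 0" if "\<not> dense w s" for s
    using that by (simp add: \<phi>_def)
  ultimately have "closed (branches w) \<and> \<phi> [] \<le> prob (branches w)"
    unfolding * using prob_branches_ge[of "dense w" \<phi> ?t] split le by blast
  moreover have "\<phi> [] = M w / 2"
    using dense_Nil[OF assms] prob_cyl_pos[OF assms] by (simp add: \<phi>_def ratio_def)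
  ultimately show "closed (branches w)" "M w / 2 \<le> prob (branches w)"
    by auto
qed

text \<open>The points from which II cannot play the digit \<open>k\<close> and stay on a set of positive measure.
  They have no density points, because after every such digit the mass I must distribute is a
  fixed proportion of the measure of the cylinder.\<close>

definition stuck :: "II_move list \<Rightarrow> nat \<Rightarrow> (nat \<Rightarrow> bool) set" where
  "stuck w k = branches w -
     (\<Union>(s, b)\<in>{(s, b). dense w (s @ [b])}. branches (no_digits w s @ [(b, Some k)]))"

lemma L_digit:
  assumes "L w" "dense w (s @ [b])"
  shows "L (no_digits w s @ [(b, Some k)])"
    and "M (no_digits w s @ [(b, Some k)]) = M (no_digits w (s @ [b]))"
proof -
  have L: "L (no_digits w s)" "L (no_digits w (s @ [b]))"
    using assms dense_imp_L by (auto simp: dense_snoc)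
  show M: "M (no_digits w s @ [(b, Some k)]) = M (no_digits w (s @ [b]))"
    unfolding no_digits_snoc by (rule M_digit_irrelevant[OF L(1)])
  show "L (no_digits w s @ [(b, Some k)])"
    using L M by (simp add: L_snoc no_digits_snoc)
qed

lemma stuck_null:
  assumes "L w"
  shows "stuck w k \<in> null_sets \<mu>"
proof -
  have meas: "stuck w k \<in> sets \<mu>"
    unfolding stuck_def
    using branches_large(1) assms L_digit(1)
    by (intro sets.Diff sets.countable_UN' sets_closed) (auto intro!: sets_closed)
  \<comment> \<open>In each such cylinder the mass exceeds \<open>ratio w\<close> times the measure,
    and branches of measure at least half that mass survive the digit \<open>k\<close>, disjoint
    from \<open>stuck w k\<close>. A digit is attached to a bit played after \<open>w\<close>, hence
    the bound \<open>Suc (length w)\<close>.\<close>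
  have "prob (stuck w k) = 0"
  proof (rule prob_eq_0_of_density_le[OF meas, of "1 - ratio w / 2" "Suc (length w)"])
    show "0 \<le> 1 - ratio w / 2" "1 - ratio w / 2 < 1"
      using ratio_bounds[OF assms] by auto
  next
    fix x n
    assume x: "x \<in> stuck w k" and n: "Suc (length w) \<le> n"
    then have xb: "x \<in> cyl (map fst w)" "\<And>j. dense w (map x [length w..<length w + j])"
      by (auto simp: stuck_def branches_def)
    define s b where "s = map x [length w..<n - 1]" and "b = x (n - 1)"
    have sb: "s @ [b] = map x [length w..<length w + (n - length w)]"
      using n by (cases n) (auto simp: s_def b_def)
    have dns: "dense w (s @ [b])"
      unfolding sb by (rule xb(2))
    have "map x [0..<n] = map x [0..<length w] @ map x [length w..<length w + (n - length w)]"
      using n upt_add_eq_append[of 0 "length w" "n - length w"] by simp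
    moreover have "map x [0..<length w] = map fst w"
      using xb(1) mem_cyl_iff[of x "map fst w"] by simp
    ultimately have pre: "map x [0..<n] = map fst w @ s @ [b]"
      using sb by simp
    let ?K = "cyl (map fst w @ s @ [b])" and ?w = "no_digits w s @ [(b, Some k)]"
    have large: "M (no_digits w (s @ [b])) / 2 \<le> prob (branches ?w)" "closed (branches ?w)"
      using branches_large[OF L_digit(1)[OF assms dns, of k]] L_digit(2)[OF assms dns, of k] by auto
    have sub: "branches ?w \<subseteq> ?K"
      by (auto simp: branches_def)
    have "branches ?w \<inter> stuck w k = {}"
      using dns by (auto simp: stuck_def)
    then have "prob ((stuck w k \<inter> ?K) \<union> branches ?w) = prob (stuck w k \<inter> ?K) + prob (branches ?w)"
      using meas sets_cyl sets_closed[OF large(2)] by (intro finite_measure_Union) auto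
    moreover have "prob ((stuck w k \<inter> ?K) \<union> branches ?w) \<le> prob ?K"
      using sub by (intro finite_measure_mono sets_cyl) auto
    moreover have "ratio w * prob ?K < M (no_digits w (s @ [b]))"
      using dense_imp_mass[OF assms dns] by simp
    ultimately show "prob (stuck w k \<inter> cyl (map x [0..<n]))
        \<le> (1 - ratio w / 2) * prob (cyl (map x [0..<n]))"
      using large(1) by (simp add: pre algebra_simps)
  qed
  then show ?thesis
    using meas by (simp add: null_sets_def emeasure_eq_measure)
qed

text \<open>There are only countably many pairs of a history and a digit, so all stuck sets together
  are null, whereas \<open>branches []\<close> has positive measure.\<close>

lemma exists_unstuck: "\<exists>x. x \<in> branches [] \<and> (\<forall>w k. L w \<longrightarrow> x \<notin> stuck w k)"
proof (rule ccontr)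
  assume "\<not> ?thesis"
  then have "branches [] \<subseteq> (\<Union>(w, k)\<in>{(w, k). L w}. stuck w k)"
    by auto
  moreover have "(\<Union>(w, k)\<in>{(w, k). L w}. stuck w k) \<in> null_sets \<mu>"
    by (intro null_sets_UN') (auto intro: stuck_null)
  ultimately have "branches [] \<in> null_sets \<mu>"
    using branches_large(1)[OF L_Nil] by (meson null_sets_subset sets_closed)
  then have "prob (branches []) = 0"
    by (simp add: measure_def null_sets_def)
  then show False
    using branches_large(2)[OF L_Nil] M_pos[OF L_Nil] by simp
qed

lemma unstuck_digit:
  assumes "L w" "x \<in> branches w" "x \<notin> stuck w k"
  obtains s b where "L (no_digits w s @ [(b, Some k)])"
    "x \<in> branches (no_digits w s @ [(b, Some k)])"
proof -
  obtain s b where "dense w (s @ [b])" "x \<in> branches (no_digits w s @ [(b, Some k)])"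
    using assms by (auto simp: stuck_def)
  then show thesis
    using L_digit(1)[OF assms(1)] that by blast
qed

text \<open>The point \<open>x\<close> comes before \<open>y\<close>: one point must serve all
  \<open>y\<close>, because the \<open>y\<close> used later is chosen according to
  \<open>x\<close>.\<close>

lemma II_can_play:
  "\<exists>x. \<forall>y. \<exists>v. (\<forall>n. L (map v [0..<n])) \<and> (\<forall>n. fst (v n) = x n) \<and>
     infinite {n. snd (v n) \<noteq> None} \<and>
     (\<forall>i. snd (v (enumerate {n. snd (v n) \<noteq> None} i)) = Some (y i))"
proof -
  obtain x where x: "x \<in> branches []" "\<And>w k. L w \<Longrightarrow> x \<notin> stuck w k"
    using exists_unstuck by blast
  have "\<exists>v. (\<forall>n. L (map v [0..<n])) \<and> (\<forall>n. fst (v n) = x n) \<and> infinite {n. snd (v n) \<noteq> None} \<and>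
     (\<forall>i. snd (v (enumerate {n. snd (v n) \<noteq> None} i)) = Some (y i))" for y :: "nat \<Rightarrow> nat"
  proof -
    \<comment> \<open>\<open>W i\<close> is the history just after the first \<open>i\<close> digits
      of \<open>y\<close>. The invariant that \<open>x\<close> is in \<open>branches (W i)\<close>
      makes the next digit possible, since \<open>x\<close> is never stuck.\<close>
    have "\<exists>W. \<forall>i. (L (W i) \<and> x \<in> branches (W i) \<and> (i = 0 \<longrightarrow> W i = [])) \<and>
        (\<exists>s b. W (Suc i) = no_digits (W i) s @ [(b, Some (y i))])"
    proof (rule dependent_nat_choice)
      show "\<exists>w. L w \<and> x \<in> branches w \<and> (0 = 0 \<longrightarrow> w = [])"
        using L_Nil x(1) by blast
      show "\<exists>w'. (L w' \<and> x \<in> branches w' \<and> (Suc i = 0 \<longrightarrow> w' = [])) \<and>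
          (\<exists>s b. w' = no_digits w s @ [(b, Some (y i))])"
        if "L w \<and> x \<in> branches w \<and> (i = 0 \<longrightarrow> w = [])" for w i
        using that x(2) unstuck_digit[of w x "y i"] by (metis Zero_not_Suc)
    qed
    then obtain W where W: "\<And>i. L (W i)" "\<And>i. x \<in> branches (W i)" "W 0 = []"
      and "\<And>i. \<exists>s b. W (Suc i) = no_digits (W i) s @ [(b, Some (y i))]"
      by blast
    then obtain s b where Suc: "\<And>i. W (Suc i) = no_digits (W i) (s i) @ [(b i, Some (y i))]"
      by metis
    have len: "length (W (Suc i)) = Suc (length (W i) + length (s i))" for i
      by (simp add: Suc)
    have len_ge: "i \<le> length (W i)" for i
      by (induction i) (auto simp: len)
    have mono: "i \<le> j \<Longrightarrow> length (W i) \<le> length (W j)" for i j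
      by (rule lift_Suc_mono_le[of "\<lambda>i. length (W i)"]) (simp_all add: len)
    have nth_le: "W j ! n = W i ! n" if "i \<le> j" "n < length (W i)" for i j n
      using that(1)
    proof (induction j rule: dec_induct)
      case (step j)
      have "n < length (W j)" using mono[OF step(1)] that(2) by simp
      then have "W (Suc j) ! n = W j ! n"
        by (simp add: Suc no_digits_def nth_append)
      then show ?case using step by simp
    qed simp
    \<comment> \<open>Every stage adds at least one move, so \<open>W (Suc n)\<close> has an entry
      at \<open>n\<close>, and later stages do not change it.\<close>
    define v where "v n = W (Suc n) ! n" for n
    have v_eq: "v n = W i ! n" if "n < length (W i)" for n i
    proof (cases "i \<le> Suc n")
      case True
      then show ?thesis using nth_le[OF True that] by (simp add: v_def)
    next
      case False
      then show ?thesis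
        using nth_le[of "Suc n" i n] len_ge[of "Suc n"] by (simp add: v_def)
    qed
    have "L (map v [0..<n])" for n
    proof -
      have "map v [0..<n] = take n (W n)"
        using len_ge[of n] v_eq[of _ n] by (intro nth_equalityI) auto
      then show ?thesis
        using L_appendD[of "take n (W n)" "drop n (W n)"] W(1) by simp
    qed
    moreover have "fst (v n) = x n" for n
      using W(2)[of "Suc n"] len_ge[of "Suc n"] by (simp add: branches_def cyl_def v_def)
    moreover define e where "e i = length (W i) + length (s i)" for i
    have v_e: "snd (v (e i)) = Some (y i)" for i
      using v_eq[of "e i" "Suc i"] by (simp add: e_def Suc nth_append)
    have e_mono: "strict_mono e"
      unfolding strict_mono_Suc_iff by (simp add: e_def len)
    have range: "{n. snd (v n) \<noteq> None} = range e"
    proof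
      show "range e \<subseteq> {n. snd (v n) \<noteq> None}"
        by (auto simp: v_e)
      show "{n. snd (v n) \<noteq> None} \<subseteq> range e"
      proof
        fix n assume n: "n \<in> {n. snd (v n) \<noteq> None}"
        \<comment> \<open>Round \<open>n\<close> lies in the block that leads from
          \<open>W i\<close> to \<open>W (Suc i)\<close>. Only the last round of that block,
          \<open>e i\<close>, carries a digit.\<close>
        define i where "i = (LEAST i. n < length (W (Suc i)))"
        have i: "n < length (W (Suc i))"
          unfolding i_def by (rule LeastI[of _ n]) (use len_ge[of "Suc n"] in simp)
        have ge: "length (W i) \<le> n"
        proof (cases i)
          case (Suc j)
          then have "\<not> n < length (W (Suc j))"
            unfolding i_def by (intro not_less_Least) (simp add: i_def)
          then show ?thesis using Suc by simp
        qed (simp add: W(3))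
        have "n = e i"
        proof (rule ccontr)
          assume "n \<noteq> e i"
          then have "n < length (W i) + length (s i)"
            using i by (simp add: len e_def)
          then have "snd (v n) = None"
            using v_eq[OF i] ge by (simp add: Suc no_digits_def nth_append)
          then show False using n by simp
        qed
        then show "n \<in> range e" by simp
      qed
    qed
    have "infinite {n. snd (v n) \<noteq> None}"
      unfolding range using e_mono strict_mono_imp_inj_on finite_imageD by blast
    moreover have "snd (v (enumerate {n. snd (v n) \<noteq> None} i)) = Some (y i)" for i
      unfolding range enumerate_range_strict_mono[OF e_mono] by (rule v_e)
    ultimately show ?thesis by blast
  qed
  then show ?thesis by blast
qed

end

section \<open>Plays against a fixed strategy of player I\<close>

definition run_I :: "I_strategy \<Rightarrow> II_move list \<Rightarrow> round list" where
  "run_I \<sigma> w = foldl (\<lambda>r v. r @ [(\<sigma> r, v)]) [] w"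

lemma run_I_Nil [simp]: "run_I \<sigma> [] = []"
  and run_I_snoc [simp]: "run_I \<sigma> (w @ [v]) = run_I \<sigma> w @ [(\<sigma> (run_I \<sigma> w), v)]"
  by (simp_all add: run_I_def)

definition play_I :: "I_strategy \<Rightarrow> (nat \<Rightarrow> II_move) \<Rightarrow> play" where
  "play_I \<sigma> v n = (\<sigma> (run_I \<sigma> (map v [0..<n])), v n)"

lemma map_play_I: "map (play_I \<sigma> v) [0..<n] = run_I \<sigma> (map v [0..<n])"
  by (induction n) (simp_all add: play_I_def)

lemma follows_play_I: "follows_I \<sigma> (play_I \<sigma> v)"
  by (simp add: follows_I_def map_play_I) (simp add: play_I_def)

definition mass_I :: "I_strategy \<Rightarrow> II_move list \<Rightarrow> rat" where
  "mass_I \<sigma> w =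
     (if w = [] then fst (\<sigma> []) + snd (\<sigma> [])
      else if fst (last w) then snd (\<sigma> (run_I \<sigma> (butlast w)))
      else fst (\<sigma> (run_I \<sigma> (butlast w))))"

lemma mass_I_snoc:
  "mass_I \<sigma> (w @ [v]) = (if fst v then snd (\<sigma> (run_I \<sigma> w)) else fst (\<sigma> (run_I \<sigma> w)))"
  by (simp add: mass_I_def)

lemma mass_play_I: "mass (play_I \<sigma> v) n = mass_I \<sigma> (map v [0..<n])"
  by (cases n) (simp_all add: mass_I_snoc play_I_def bits_def, simp add: mass_I_def)

lemma bits_before_play_I: "bits_before (play_I \<sigma> v) n = map fst (map v [0..<n])"
  by (simp add: bits_before_def bits_def play_I_def)

definition I_obeys :: "(nat \<Rightarrow> bool) measure \<Rightarrow> I_strategy \<Rightarrow> II_move list \<Rightarrow> bool" where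
  "I_obeys \<mu> \<sigma> w \<longleftrightarrow>
     (let t = map fst w; m0 = fst (\<sigma> (run_I \<sigma> w)); m1 = snd (\<sigma> (run_I \<sigma> w)) in
        (w = [] \<longrightarrow> 0 < m0 + m1) \<and> m0 + m1 = mass_I \<sigma> w \<and> admissible_mass \<mu> t (m0 + m1) \<and>
        admissible_mass \<mu> (t @ [False]) m0 \<and> admissible_mass \<mu> (t @ [True]) m1)"

lemma I_legal_play_I: "I_legal \<mu> 0 (play_I \<sigma> v) n \<longleftrightarrow> I_obeys \<mu> \<sigma> (map v [0..<n])"
  unfolding I_legal_def I_obeys_def mass_play_I bits_before_play_I
  by (simp add: play_I_def Let_def)

definition II_obeys :: "I_strategy \<Rightarrow> II_move list \<Rightarrow> bool" where
  "II_obeys \<sigma> w \<longleftrightarrow> (\<forall>k<length w. mass_I \<sigma> (take (Suc k) w) \<noteq> 0)"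

lemma II_obeys_snoc: "II_obeys \<sigma> (w @ [v]) \<longleftrightarrow> II_obeys \<sigma> w \<and> mass_I \<sigma> (w @ [v]) \<noteq> 0"
  by (auto simp: II_obeys_def less_Suc_eq)

text \<open>If I broke a rule after a history in which II obeyed, then II could repeat that history
  and win. The least violation is taken because the first violator loses; it occurs by round
  \<open>length w\<close>, so the default moves in \<open>v\<close> do not influence it.\<close>

lemma I_obeys_if_winning:
  assumes win: "\<And>p. follows_I \<sigma> p \<Longrightarrow> \<not> II_wins_play \<mu> 0 F p"
    and w: "II_obeys \<sigma> w"
  shows "I_obeys \<mu> \<sigma> w"
proof (rule ccontr)
  assume not: "\<not> I_obeys \<mu> \<sigma> w"
  define v where "v i = (if i < length w then w ! i else (False, None))" for i
  have take: "map v [0..<k] = take k w" if "k \<le> length w" for k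
    using that by (intro nth_equalityI) (auto simp: v_def)
  define n where "n = (LEAST n. \<not> I_obeys \<mu> \<sigma> (take n w))"
  have n: "\<not> I_obeys \<mu> \<sigma> (take n w)"
    unfolding n_def by (rule LeastI[of _ "length w"]) (simp add: not)
  have n_le: "n \<le> length w"
    unfolding n_def by (rule Least_le) (simp add: not)
  have "I_legal \<mu> 0 (play_I \<sigma> v) k \<and> II_legal (play_I \<sigma> v) k" if "k < n" for k
  proof
    have "I_obeys \<mu> \<sigma> (take k w)"
      using not_less_Least[of k] that unfolding n_def by blast
    then show "I_legal \<mu> 0 (play_I \<sigma> v) k"
      using take[of k] that n_le by (simp add: I_legal_play_I)
    show "II_legal (play_I \<sigma> v) k"
      unfolding II_legal_def mass_play_I
      using take[of "Suc k"] that n_le w by (simp only: II_obeys_def) simp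
  qed
  moreover have "\<not> I_legal \<mu> 0 (play_I \<sigma> v) n"
    using n take[OF n_le] by (simp add: I_legal_play_I)
  ultimately have "II_wins_play \<mu> 0 F (play_I \<sigma> v)"
    unfolding II_wins_play_def by blast
  then show False
    using win follows_play_I by blast
qed

text \<open>A winning strategy of I would have to obey the rules whenever II does, which makes its
  masses a \<open>mass_assignment\<close>; then \<open>II_can_play\<close> yields a play that II
  wins.\<close>

lemma (in cantor_prob) I_has_no_winning_strategy:
  assumes total: "\<And>x. \<exists>y. (x, y) \<in> R"
  shows "\<exists>p. follows_I \<sigma> p \<and> II_wins_play \<mu> 0 R p"
proof (rule ccontr)
  assume "\<not> ?thesis"
  then have win: "\<And>p. follows_I \<sigma> p \<Longrightarrow> \<not> II_wins_play \<mu> 0 R p"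
    by blast
  have obeys: "I_obeys \<mu> \<sigma> w" if "II_obeys \<sigma> w" for w
    using win that by (rule I_obeys_if_winning)
  define M where "M w = real_of_rat (mass_I \<sigma> w)" for w
  interpret mass_assignment \<mu> M "II_obeys \<sigma>"
  proof
    show "II_obeys \<sigma> []"
      by (simp add: II_obeys_def)
    show "II_obeys \<sigma> (w @ [v]) \<longleftrightarrow> II_obeys \<sigma> w \<and> M (w @ [v]) \<noteq> 0" for w v
      by (simp add: II_obeys_snoc M_def)
  next
    fix w assume w: "II_obeys \<sigma> w"
    note o = obeys[OF w]
    have adm: "admissible_mass \<mu> (map fst w) (mass_I \<sigma> w)"
      using o unfolding I_obeys_def Let_def by metis
    have "mass_I \<sigma> w > 0"
    proof (cases w rule: rev_cases)
      case Nil
      then show ?thesis using o by (simp add: I_obeys_def Let_def)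
    next
      case (snoc u v)
      then have "mass_I \<sigma> w \<noteq> 0"
        using w by (simp add: II_obeys_snoc)
      then show ?thesis using adm by (simp add: admissible_mass_def)
    qed
    then show "0 < M w"
      by (simp add: M_def)
    show "M w \<le> prob (cyl (map fst w))"
      using adm measure_nonneg[of \<mu> "cyl (map fst w)"]
      by (auto simp: M_def admissible_mass_def less_le)
    show "M w = M (w @ [(False, k)]) + M (w @ [(True, l)])" for k l
      using o by (simp add: M_def mass_I_snoc I_obeys_def Let_def of_rat_add[symmetric])
  qed
  obtain x where x: "\<forall>y. \<exists>v. (\<forall>n. II_obeys \<sigma> (map v [0..<n])) \<and> (\<forall>n. fst (v n) = x n) \<and>
     infinite {n. snd (v n) \<noteq> None} \<and>
     (\<forall>i. snd (v (enumerate {n. snd (v n) \<noteq> None} i)) = Some (y i))"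
    using II_can_play by blast
  obtain y where y: "(x, y) \<in> R"
    using total by blast
  from x obtain v where v: "\<And>n. II_obeys \<sigma> (map v [0..<n])" "\<And>n. fst (v n) = x n"
     "infinite {n. snd (v n) \<noteq> None}"
     "\<And>i. snd (v (enumerate {n. snd (v n) \<noteq> None} i)) = Some (y i)"
    by blast
  let ?p = "play_I \<sigma> v"
  have "I_legal \<mu> 0 ?p n" for n
    unfolding I_legal_play_I by (intro obeys v(1))
  moreover have "II_legal ?p n" for n
  proof -
    have "II_obeys \<sigma> (map v [0..<n] @ [v n])"
      using v(1)[of "Suc n"] by simp
    then have "mass_I \<sigma> (map v [0..<n] @ [v n]) \<noteq> 0"
      using II_obeys_snoc by blast
    then show ?thesis
      unfolding II_legal_def mass_play_I by simp
  qed
  moreover have rounds: "digit_rounds ?p = {n. snd (v n) \<noteq> None}"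
    by (simp add: digit_rounds_def play_I_def)
  moreover have "bits ?p = x"
    by (simp add: fun_eq_iff bits_def play_I_def v(2))
  moreover have "digits ?p = y"
  proof
    fix i
    have "digits ?p i = the (snd (v (enumerate (digit_rounds ?p) i)))"
      by (simp add: digits_def play_I_def)
    then show "digits ?p i = y i"
      unfolding rounds v(4) by simp
  qed
  ultimately have "II_wins_play \<mu> 0 R ?p"
    using v(3) y by (simp add: II_wins_play_def)
  then show False
    using win follows_play_I by blast
qed

section \<open>Following a winning strategy of player II\<close>

text \<open>Admissibility depends on a cylinder only through its measure \<open>c\<close>. This
  reduces the choice of I's move to a question about rationals.\<close>

definition admissible_below :: "real \<Rightarrow> rat \<Rightarrow> bool" where
  "admissible_below c a \<longleftrightarrow> 0 \<le> a \<and> (0 < c \<longrightarrow> of_rat a < c) \<and> (c = 0 \<longrightarrow> a = 0)"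

lemma admissible_mass_iff: "admissible_mass \<mu> t m \<longleftrightarrow> admissible_below (measure \<mu> (cyl t)) m"
  by (simp add: admissible_mass_def admissible_below_def)

lemma admissible_below_between:
  assumes "admissible_below c a" "admissible_below c b" "a \<le> x" "x \<le> b"
  shows "admissible_below c x"
proof -
  have "real_of_rat x \<le> of_rat b"
    using assms(4) by (simp add: of_rat_less_eq)
  moreover have "0 \<le> a" "c = 0 \<Longrightarrow> b = 0" "0 < c \<Longrightarrow> of_rat b < c"
    using assms(1,2) by (simp_all add: admissible_below_def)
  moreover have "0 \<le> x"
    using \<open>0 \<le> a\<close> assms(3) by (rule order_trans)
  ultimately show ?thesis
    using assms(4) unfolding admissible_below_def by (metis le_less_trans order_antisym)
qed

lemma first_switch:
  fixes n :: nat
  assumes "Q 0" "\<not> Q n"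
  obtains i where "i < n" "Q i" "\<not> Q (Suc i)"
proof -
  have "\<exists>i<n. Q i \<and> \<not> Q (Suc i)"
  proof (rule ccontr)
    assume *: "\<not> ?thesis"
    have "k \<le> n \<Longrightarrow> Q k" for k
      by (induction k) (use * assms(1) in auto)
    then show False using assms(2) by blast
  qed
  then show thesis using that by blast
qed

text \<open>If II answers a move \<open>(a, m - a)\<close> with the bit \<open>r a\<close>, then I can choose one or two moves,
  with distinct answers, after which the slack (measure minus mass) has decreased by at most \<open>\<delta>\<close>
  in total: if both answers occur, take two close values of \<open>a\<close> where the answer
  changes, otherwise take \<open>a\<close> extreme.\<close>

lemma split_with_small_loss:
  fixes c0 c1 \<delta> :: real and m :: rat and r :: "rat \<Rightarrow> bool"
  defines "legal \<equiv> \<lambda>a. admissible_below c0 a \<and> admissible_below c1 (m - a)"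
  assumes "0 \<le> c0" "0 \<le> c1" "0 < \<delta>" "0 < m" "of_rat m < c0 + c1"
    and nonzero: "\<And>a. legal a \<Longrightarrow> if r a then a \<noteq> m else a \<noteq> 0"
  shows "(\<exists>a. legal a \<and> \<not> r a \<and> of_rat a \<le> of_rat m - c1 + \<delta>) \<or>
    (\<exists>a. legal a \<and> r a \<and> c0 - \<delta> \<le> of_rat a) \<or>
    (\<exists>a a'. legal a \<and> r a \<and> legal a' \<and> \<not> r a' \<and> of_rat a' \<le> of_rat a + \<delta>)"
proof -
  consider (both) a a' where "legal a" "r a" "legal a'" "\<not> r a'"
    | (False) "\<And>a. legal a \<Longrightarrow> \<not> r a" | (True) "\<And>a. legal a \<Longrightarrow> r a"
    by blast
  then show ?thesis
  proof cases
    case both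
    show ?thesis
    proof (cases "a' \<le> a")
      case True
      then have "real_of_rat a' \<le> of_rat a" by (simp add: of_rat_less_eq)
      then show ?thesis using both \<open>0 < \<delta>\<close> by force
    next
      case False
      \<comment> \<open>The interval from \<open>a\<close> to \<open>a'\<close> is cut into steps
        shorter than \<open>\<delta>\<close>. All grid points are legal, as legality is a condition
        between bounds, and the answer changes between two neighbours.\<close>
      obtain N :: nat where N: "real_of_rat (a' - a) / \<delta> < real N"
        using reals_Archimedean2 by blast
      have pos: "0 < real_of_rat (a' - a)" using False by simp
      have "0 < real N"
        using N \<open>0 < \<delta>\<close> pos by (meson divide_pos_pos order_less_trans)
      then have "0 < N" by simp
      define g where "g i = a + (a' - a) * of_nat i / of_nat N" for i
      have g0: "g 0 = a" and gN: "g N = a'"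
        using \<open>0 < N\<close> by (simp_all add: g_def)
      have "r (g 0)" "\<not> r (g N)"
        using both g0 gN by simp_all
      then obtain i where i: "i < N" "r (g i)" "\<not> r (g (Suc i))"
        using first_switch[of "\<lambda>i. r (g i)" N] by blast
      have leg: "legal (g j)" if "j \<le> N" for j
      proof -
        have "0 \<le> (a' - a) * of_nat j / of_nat N"
          using False by simp
        then have 1: "a \<le> g j"
          by (simp add: g_def)
        have "(a' - a) * (of_nat j / of_nat N) \<le> a' - a"
          using False that \<open>0 < N\<close> by (intro mult_left_le) (auto simp: divide_le_eq)
        then have 2: "g j \<le> a'"
          by (simp add: g_def)
        show ?thesis
          using both 1 2 admissible_below_between[of c0 a a' "g j"]
            admissible_below_between[of c1 "m - a'" "m - a" "m - g j"]
          by (simp add: legal_def)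
      qed
      have "g (Suc i) = g i + (a' - a) / of_nat N"
        by (simp add: g_def add_divide_distrib distrib_left)
      then have "real_of_rat (g (Suc i)) = of_rat (g i) + of_rat (a' - a) / real N"
        by (simp add: of_rat_add of_rat_divide)
      also have "of_rat (a' - a) / real N \<le> \<delta>"
        using N \<open>0 < \<delta>\<close> \<open>0 < N\<close> by (simp add: field_simps)
      finally show ?thesis
        using i leg[of i] leg[of "Suc i"] by force
    qed
  next
    case False
    \<comment> \<open>Answering False to \<open>a = 0\<close> would select mass 0. So
      \<open>m\<close> is too large for the True side: either \<open>c1 = 0\<close>, where
      \<open>a = m\<close> is forced, or \<open>c1 \<le> m\<close>, and \<open>a\<close> can be
      taken just above \<open>m - c1\<close>.\<close>
    have "\<not> legal 0"
      using False nonzero[of 0] by auto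
    then have "\<not> admissible_below c1 m"
      using \<open>0 \<le> c0\<close> by (auto simp: legal_def admissible_below_def)
    then consider "c1 = 0" | "0 < c1" "c1 \<le> of_rat m"
      using \<open>0 < m\<close> \<open>0 \<le> c1\<close> by (fastforce simp: admissible_below_def)
    then show ?thesis
    proof cases
      case 1
      then have "legal m"
        using assms(4-6) by (auto simp: legal_def admissible_below_def)
      then show ?thesis
        using False[of m] 1 \<open>0 < \<delta>\<close> by (intro disjI1 exI[of _ m]) simp
    next
      case 2
      have "of_rat m - c1 < min (of_rat m - c1 + \<delta>) (min c0 (of_rat m))"
        using assms(4-6) 2 by auto
      then obtain a where a: "of_rat m - c1 < of_rat a"
          "of_rat a < min (of_rat m - c1 + \<delta>) (min c0 (of_rat m))"
        using of_rat_dense by blast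
      then have "0 < real_of_rat a" "real_of_rat a < of_rat m"
        using 2 by linarith+
      then have "0 < a" "a < m"
        by (simp_all add: of_rat_less)
      then have "legal a"
        using a 2 by (auto simp: legal_def admissible_below_def of_rat_diff)
      then show ?thesis
        using False[of a] a by (intro disjI1 exI[of _ a]) simp
    qed
  next
    case True
    \<comment> \<open>Symmetrically, \<open>a = m\<close> leaves mass 0 on the True side; hence
      \<open>c0 = 0\<close>, or \<open>a\<close> can be taken just below \<open>c0\<close>.\<close>
    have "\<not> legal m"
      using True nonzero[of m] by auto
    then have "\<not> admissible_below c0 m"
      using \<open>0 \<le> c1\<close> by (auto simp: legal_def admissible_below_def)
    then consider "c0 = 0" | "0 < c0" "c0 \<le> of_rat m"
      using \<open>0 < m\<close> \<open>0 \<le> c0\<close> by (fastforce simp: admissible_below_def)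
    then show ?thesis
    proof cases
      case 1
      then have "legal 0"
        using assms(4-6) by (auto simp: legal_def admissible_below_def)
      then show ?thesis
        using True[of 0] 1 \<open>0 < \<delta>\<close> by (intro disjI2 disjI1 exI[of _ 0]) simp
    next
      case 2
      have "max (c0 - \<delta>) (max (of_rat m - c1) 0) < c0"
        using assms(4-6) 2 by auto
      then obtain a where a: "max (c0 - \<delta>) (max (of_rat m - c1) 0) < of_rat a" "of_rat a < c0"
        using of_rat_dense by blast
      then have "0 < real_of_rat a" "real_of_rat a < of_rat m"
        using 2 by linarith+
      then have "0 < a" "a < m"
        by (simp_all add: of_rat_less)
      then have "legal a"
        using a 2 by (auto simp: legal_def admissible_below_def of_rat_diff)
      then show ?thesis
        using True[of a] a by (intro disjI2 disjI1 exI[of _ a]) simp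
    qed
  qed
qed

section \<open>Finite positions consistent with a strategy of player II\<close>

definition pos_bits :: "round list \<Rightarrow> bool list" where
  "pos_bits u = map (fst \<circ> snd) u"

lemma pos_bits_Nil [simp]: "pos_bits [] = []"
  and pos_bits_snoc [simp]: "pos_bits (u @ [r]) = pos_bits u @ [fst (snd r)]"
  by (simp_all add: pos_bits_def)

text \<open>In the game the total mass is read off I's first move. Fixing it in advance as \<open>m\<close> gives a mass to
  the empty position as well.\<close>

definition pos_mass :: "rat \<Rightarrow> round list \<Rightarrow> rat" where
  "pos_mass m u =
     (if u = [] then m
      else if fst (snd (last u)) then snd (fst (last u)) else fst (fst (last u)))"

lemma pos_mass_Nil [simp]: "pos_mass m [] = m"
  and pos_mass_snoc [simp]:
    "pos_mass m (u @ [r]) = (if fst (snd r) then snd (fst r) else fst (fst r))"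
  by (simp_all add: pos_mass_def)

text \<open>Only I's rules are imposed here; that II obeys the rules is derived in
  \<open>pos_mass_pos\<close> from \<open>\<tau>\<close> being winning.\<close>

inductive position :: "(nat \<Rightarrow> bool) measure \<Rightarrow> II_strategy \<Rightarrow> rat \<Rightarrow> round list \<Rightarrow> bool"
  for \<mu> \<tau> m where
  Nil: "position \<mu> \<tau> m []"
| snoc: "position \<mu> \<tau> m u \<Longrightarrow> a + b = pos_mass m u \<Longrightarrow>
    admissible_mass \<mu> (pos_bits u @ [False]) a \<Longrightarrow> admissible_mass \<mu> (pos_bits u @ [True]) b \<Longrightarrow>
    position \<mu> \<tau> m (u @ [((a, b), \<tau> u (a, b))])"

lemma position_snocD:
  assumes "position \<mu> \<tau> m (u @ [r])"
  shows "position \<mu> \<tau> m u" "fst (fst r) + snd (fst r) = pos_mass m u"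
    "admissible_mass \<mu> (pos_bits u @ [False]) (fst (fst r))"
    "admissible_mass \<mu> (pos_bits u @ [True]) (snd (fst r))"
    "snd r = \<tau> u (fst r)"
  using assms by (cases rule: position.cases; simp)+

lemma position_take: "position \<mu> \<tau> m u \<Longrightarrow> position \<mu> \<tau> m (take k u)"
proof (induction rule: position.induct)
  case (snoc u a b)
  then have "position \<mu> \<tau> m (u @ [((a, b), \<tau> u (a, b))])"
    by (intro position.snoc)
  then show ?case
    using snoc.IH by (cases "k \<le> length u") (simp_all add: take_Cons')
qed (simp add: position.Nil)

lemma mass_eq_pos_mass:
  assumes "fst (fst (p 0)) + snd (fst (p 0)) = m"
  shows "mass p n = pos_mass m (map p [0..<n])"
  using assms by (cases n) (simp_all add: bits_def)

lemma pos_bits_map: "pos_bits (map p [0..<n]) = bits_before p n"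
  by (simp add: pos_bits_def bits_before_def bits_def)

lemma (in cantor_prob) position_admissible:
  assumes "position \<mu> \<tau> m u" "0 < m" "m < 1"
  shows "admissible_mass \<mu> (pos_bits u) (pos_mass m u)"
  using assms
proof (induction rule: position.induct)
  case Nil
  then show ?case by (simp add: admissible_mass_def prob_UNIV)
next
  case (snoc u a b)
  then show ?case by (cases "fst (\<tau> u (a, b))") simp_all
qed

lemma (in cantor_prob) I_legal_of_position:
  assumes "position \<mu> \<tau> m (map p [0..<Suc n])" "0 < m" "m < 1"
  shows "I_legal \<mu> 0 p n"
proof -
  have snoc: "position \<mu> \<tau> m (map p [0..<n] @ [p n])"
    using assms(1) by simp
  note D = position_snocD[OF snoc]
  \<comment> \<open>The first round shows that I's opening total is \<open>m\<close>, so
    \<open>mass p\<close> and \<open>pos_mass m\<close> agree.\<close>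
  have "position \<mu> \<tau> m (take 1 (map p [0..<Suc n]))"
    by (rule position_take[OF assms(1)])
  then have "position \<mu> \<tau> m ([] @ [p 0])"
    by (simp add: take_map upt_conv_Cons del: upt_Suc)
  then have p0: "fst (fst (p 0)) + snd (fst (p 0)) = m"
    using position_snocD(2) by fastforce
  have "fst (fst (p n)) + snd (fst (p n)) = mass p n"
    using D(2) mass_eq_pos_mass[of p m n, OF p0] by simp
  moreover have "admissible_mass \<mu> (bits_before p n) (fst (fst (p n)) + snd (fst (p n)))"
    using position_admissible[OF D(1) assms(2,3)] D(2) by (simp add: pos_bits_map)
  moreover have "n = 0 \<longrightarrow> (0 :: real) < of_rat (fst (fst (p n)) + snd (fst (p n)))"
    using p0 \<open>0 < m\<close> by auto
  ultimately show ?thesis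
    using D(3,4) by (simp add: I_legal_def Let_def pos_bits_map)
qed

fun run_II :: "II_strategy \<Rightarrow> (nat \<Rightarrow> I_move) \<Rightarrow> nat \<Rightarrow> round list" where
  "run_II \<tau> z 0 = []"
| "run_II \<tau> z (Suc n) = run_II \<tau> z n @ [(z n, \<tau> (run_II \<tau> z n) (z n))]"

text \<open>Winning is a property of infinite plays, so a position has to be continued. After
  \<open>u\<close> I plays the arbitrary pair \<open>(0, 0)\<close>, whether legal or not.\<close>

lemma position_extends_to_play:
  assumes "position \<mu> \<tau> m u"
  obtains p where "follows_II \<tau> p" "map p [0..<length u] = u"
proof -
  define z where "z n = (if n < length u then fst (u ! n) else (0, 0))" for n
  define p where "p n = (z n, \<tau> (run_II \<tau> z n) (z n))" for n
  have run: "map p [0..<n] = run_II \<tau> z n" for n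
    by (induction n) (simp_all add: p_def)
  then have "follows_II \<tau> p"
    by (simp add: follows_II_def p_def)
  moreover have "run_II \<tau> z n = take n u" if "n \<le> length u" for n
    using that
  proof (induction n)
    case (Suc n)
    then have "position \<mu> \<tau> m (take n u @ [u ! n])"
      using position_take[OF assms, of "Suc n"] by (simp add: take_Suc_conv_app_nth)
    then have "snd (u ! n) = \<tau> (take n u) (fst (u ! n))"
      by (rule position_snocD(5))
    then have "(z n, \<tau> (take n u) (z n)) = u ! n"
      using Suc.prems by (simp add: z_def prod_eq_iff)
    then show ?case
      using Suc by (simp add: take_Suc_conv_app_nth)
  qed simp
  ultimately show thesis
    using that run by simp
qed

section \<open>The tree of positions for a winning strategy of player II\<close>

locale II_winning = cantor_prob +
  fixes \<tau> :: II_strategy and R :: "((nat \<Rightarrow> bool) \<times> (nat \<Rightarrow> nat)) set" and m :: rat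
  assumes win: "\<And>p. follows_II \<tau> p \<Longrightarrow> II_wins_play \<mu> 0 R p"
    and m_pos: "0 < m" and m_less_1: "m < 1"
begin

text \<open>In a play through \<open>u\<close> I is legal in all rounds of \<open>u\<close>. As II
  wins it, II must also be legal in these rounds, so the bit chosen last has nonzero mass.\<close>

lemma pos_mass_pos:
  assumes "position \<mu> \<tau> m u"
  shows "0 < pos_mass m u"
proof -
  have "pos_mass m u \<noteq> 0"
  proof (cases u rule: rev_cases)
    case (snoc w r)
    obtain p where p: "follows_II \<tau> p" "map p [0..<length u] = u"
      using position_extends_to_play[OF assms] by blast
    have I: "I_legal \<mu> 0 p n" if "n < length u" for n
    proof -
      have "map p [0..<Suc n] = take (Suc n) (map p [0..<length u])"
        using that by (simp add: take_map del: upt_Suc)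
      then show ?thesis
        using position_take[OF assms, of "Suc n"] p(2) m_pos m_less_1 I_legal_of_position by simp
    qed
    have "II_legal p (length w)"
      using win[OF p(1)] I snoc unfolding II_wins_play_def
      by (metis length_append_singleton less_Suc_eq not_less_eq)
    moreover have "p (length w) = r"
      using p(2) snoc by simp
    ultimately show ?thesis
      using snoc by (simp add: II_legal_def bits_def split: if_splits)
  qed (use m_pos in simp)
  moreover have "0 \<le> pos_mass m u"
    using position_admissible[OF assms m_pos m_less_1] by (simp add: admissible_mass_def)
  ultimately show ?thesis by simp
qed

definition slack :: "round list \<Rightarrow> real" where
  "slack u = prob (cyl (pos_bits u)) - of_rat (pos_mass m u)"

definition opt_slack :: "round list option \<Rightarrow> real" where
  "opt_slack z = (case z of None \<Rightarrow> 0 | Some u \<Rightarrow> slack u)"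

definition successor :: "round list \<Rightarrow> bool \<Rightarrow> round list \<Rightarrow> bool" where
  "successor u b u' \<longleftrightarrow> position \<mu> \<tau> m u' \<and> pos_bits u' = pos_bits u @ [b] \<and> (\<exists>r. u' = u @ [r])"

text \<open>A move \<open>(a, n - a)\<close> leaves slack \<open>c0 - a\<close> after False and
  \<open>c1 - (n - a)\<close> after True. The three cases of \<open>split_with_small_loss\<close>
  thus give one successor of either kind, or two whose slacks sum to
  \<open>slack u - (a' - a)\<close>.\<close>

lemma successors_exist:
  assumes u: "position \<mu> \<tau> m u" and "0 < \<delta>"
  shows "\<exists>h. (\<forall>b u'. h b = Some u' \<longrightarrow> successor u b u') \<and>
     slack u - \<delta> \<le> opt_slack (h False) + opt_slack (h True)"
proof -
  let ?t = "pos_bits u"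
  define c0 c1 n where "c0 = prob (cyl (?t @ [False]))" and "c1 = prob (cyl (?t @ [True]))"
    and "n = pos_mass m u"
  define nxt where "nxt a = u @ [((a, n - a), \<tau> u (a, n - a))]" for a
  define r where "r a = fst (\<tau> u (a, n - a))" for a
  define legal where "legal a \<longleftrightarrow> admissible_below c0 a \<and> admissible_below c1 (n - a)" for a
  have t: "prob (cyl ?t) = c0 + c1"
    unfolding c0_def c1_def by (rule prob_cyl_split)
  have n: "0 < n" "of_rat n < c0 + c1"
  proof -
    show "0 < n" unfolding n_def by (rule pos_mass_pos[OF u])
    then show "of_rat n < c0 + c1"
      using position_admissible[OF u m_pos m_less_1] measure_nonneg[of \<mu> "cyl ?t"] t
      by (auto simp: admissible_mass_def n_def less_le)
  qed
  have pos: "position \<mu> \<tau> m (nxt a)" if "legal a" for a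
    unfolding nxt_def using that u
    by (intro position.snoc) (auto simp: legal_def admissible_mass_iff c0_def c1_def n_def)
  have succ: "successor u (r a) (nxt a)" if "legal a" for a
    using pos[OF that] by (simp add: successor_def nxt_def r_def)
  have slack_next: "slack (nxt a) = (if r a then c1 - (of_rat n - of_rat a) else c0 - of_rat a)" for a
    by (simp add: slack_def nxt_def r_def c0_def c1_def of_rat_diff)
  have nonzero: "if r a then a \<noteq> n else a \<noteq> 0" if "legal a" for a
    using pos_mass_pos[OF pos[OF that]] by (auto simp: nxt_def r_def split: if_splits)
  have slack_u: "slack u = c0 + c1 - of_rat n"
    by (simp add: slack_def t n_def)
  have "(\<exists>a. legal a \<and> \<not> r a \<and> of_rat a \<le> of_rat n - c1 + \<delta>) \<or>
    (\<exists>a. legal a \<and> r a \<and> c0 - \<delta> \<le> of_rat a) \<or>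
    (\<exists>a a'. legal a \<and> r a \<and> legal a' \<and> \<not> r a' \<and> of_rat a' \<le> of_rat a + \<delta>)"
    unfolding legal_def
    by (rule split_with_small_loss) (use n \<open>0 < \<delta>\<close> nonzero legal_def in \<open>auto simp: c0_def c1_def\<close>)
  then consider a where "legal a" "\<not> r a" "of_rat a \<le> of_rat n - c1 + \<delta>"
    | a where "legal a" "r a" "c0 - \<delta> \<le> of_rat a"
    | a a' where "legal a" "r a" "legal a'" "\<not> r a'" "of_rat a' \<le> of_rat a + \<delta>"
    by blast
  then show ?thesis
  proof cases
    case 1
    then show ?thesis
      using succ[of a]
      by (intro exI[of _ "\<lambda>b. if b then None else Some (nxt a)"])
        (auto simp: opt_slack_def slack_next slack_u)
  next
    case 2
    then show ?thesis
      using succ[of a]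
      by (intro exI[of _ "\<lambda>b. if b then Some (nxt a) else None"])
        (auto simp: opt_slack_def slack_next slack_u)
  next
    case 3
    then show ?thesis
      using succ[of a] succ[of a']
      by (intro exI[of _ "\<lambda>b. if b then Some (nxt a) else Some (nxt a')"])
        (auto simp: opt_slack_def slack_next slack_u)
  qed
qed

lemma continuous_uniformization:
  assumes "0 < \<eta>"
  shows "\<exists>A f. closed A \<and> 1 - of_rat m - \<eta> \<le> prob A \<and>
    continuous_on A (f :: (nat \<Rightarrow> bool) \<Rightarrow> (nat \<Rightarrow> nat)) \<and> (\<forall>x\<in>A. (x, f x) \<in> R)"
proof -
  \<comment> \<open>Level \<open>n\<close> has at most \<open>2 ^ n\<close> positions, each losing
    at most \<open>\<eta> / 4 ^ n / 2\<close>, so the losses of all levels sum to at most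
    \<open>\<eta>\<close>.\<close>
  have "\<forall>u. \<exists>h. position \<mu> \<tau> m u \<longrightarrow> (\<forall>b u'. h b = Some u' \<longrightarrow> successor u b u') \<and>
     slack u - \<eta> / 4 ^ length u / 2 \<le> opt_slack (h False) + opt_slack (h True)"
    using successors_exist assms by auto
  then obtain H where H: "\<And>u b u'. position \<mu> \<tau> m u \<Longrightarrow> H u b = Some u' \<Longrightarrow> successor u b u'"
    "\<And>u. position \<mu> \<tau> m u \<Longrightarrow>
      slack u - \<eta> / 4 ^ length u / 2 \<le> opt_slack (H u False) + opt_slack (H u True)"
    by metis
  \<comment> \<open>The unique tree position with bits \<open>s\<close>, if there is one; once a
    branch has died, \<open>None\<close> propagates.\<close>
  define pos where "pos s = foldl (\<lambda>z b. Option.bind z (\<lambda>u. H u b)) (Some []) s" for s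
  have pos_Nil: "pos [] = Some []" and pos_snoc: "pos (s @ [b]) = Option.bind (pos s) (\<lambda>u. H u b)" for s b
    by (simp_all add: pos_def)
  have pos_Some: "pos s = Some u \<Longrightarrow> position \<mu> \<tau> m u \<and> pos_bits u = s" for s u
  proof (induction s arbitrary: u rule: rev_induct)
    case Nil
    then show ?case by (simp add: pos_Nil position.Nil)
  next
    case (snoc b s)
    then obtain w where "pos s = Some w" "H w b = Some u"
      by (auto simp: pos_snoc bind_eq_Some_conv)
    then show ?case
      using snoc.IH[of w] H(1)[of w b u] by (simp add: successor_def)
  qed
  have length_pos: "length u = length s" if "pos s = Some u" for s u
    using pos_Some[OF that] by (auto simp: pos_bits_def)
  \<comment> \<open>The subtracted term is a reserve for losses at and below \<open>s\<close>: half
    is spent at the node and a quarter passes to each child.\<close>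
  define \<phi> where "\<phi> s = (case pos s of None \<Rightarrow> 0 | Some u \<Rightarrow> slack u - \<eta> / 4 ^ length s)" for s
  define A where "A = {x. \<forall>n. pos (map x [0..<n]) \<noteq> None}"
  have split: "\<phi> s \<le> \<phi> (s @ [False]) + \<phi> (s @ [True])" for s
  proof (cases "pos s")
    case (Some u)
    have *: "opt_slack (H u b) - \<eta> / 4 ^ length s / 4 \<le> \<phi> (s @ [b])" for b
      using Some assms by (auto simp: \<phi>_def pos_snoc opt_slack_def split: option.split)
    show ?thesis
      using H(2)[of u] pos_Some[OF Some] length_pos[OF Some] *[of False] *[of True] Some
      by (simp add: \<phi>_def)
  qed (simp add: \<phi>_def pos_snoc)
  have prefix: "pos s \<noteq> None" if "pos (s @ [b]) \<noteq> None" for s b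
    using that by (cases "pos s") (simp_all add: pos_snoc)
  have out: "\<phi> s \<le> 0" if "\<not> pos s \<noteq> None" for s
    using that by (simp add: \<phi>_def)
  have le: "\<phi> s \<le> prob (cyl ([] @ s))" if s: "pos s \<noteq> None" for s
  proof -
    obtain u where u: "pos s = Some u" using s by blast
    have "0 \<le> real_of_rat (pos_mass m u)"
      using pos_mass_pos[of u] pos_Some[OF u] by simp
    moreover have "0 \<le> \<eta> / 4 ^ length s"
      using assms by simp
    moreover have "\<phi> s = prob (cyl ([] @ s)) - of_rat (pos_mass m u) - \<eta> / 4 ^ length s"
      using pos_Some[OF u] u by (simp add: \<phi>_def slack_def)
    ultimately show ?thesis
      by linarith
  qed
  have \<phi>_Nil: "\<phi> [] = 1 - of_rat m - \<eta>"
    by (simp add: \<phi>_def pos_Nil slack_def prob_UNIV)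
  have A_eq: "A = {x \<in> cyl [].
      \<forall>n. pos (map x [length ([] :: bool list)..<length ([] :: bool list) + n]) \<noteq> None}"
    by (simp add: A_def)
  have A: "closed A" "1 - of_rat m - \<eta> \<le> prob A"
    unfolding A_eq \<phi>_Nil[symmetric]
    using prob_branches_ge[of "\<lambda>s. pos s \<noteq> None" \<phi> "[]"] prefix split le out by blast+
  define u where "u x n = the (pos (map x [0..<n]))" for x n
  have u: "pos (map x [0..<n]) = Some (u x n)" if "x \<in> A" for x n
    using that by (auto simp: A_def u_def)
  have u_pos: "position \<mu> \<tau> m (u x n)" "pos_bits (u x n) = map x [0..<n]" if "x \<in> A" for x n
    using pos_Some[OF u[OF that]] by auto
  have length_u: "length (u x n) = n" if "x \<in> A" for x n
    using length_pos[OF u[OF that, of n]] by simp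
  define p where "p x n = u x (Suc n) ! n" for x n
  have u_Suc: "u x (Suc n) = u x n @ [p x n]" if x: "x \<in> A" for x n
  proof -
    have "H (u x n) (x n) = Some (u x (Suc n))"
      using u[OF x, of "Suc n"] u[OF x, of n] by (simp add: pos_snoc)
    then obtain r where "u x (Suc n) = u x n @ [r]"
      using H(1)[OF u_pos(1)[OF x, of n]] unfolding successor_def by blast
    then show ?thesis
      using length_u[OF x, of n] by (simp add: p_def nth_append)
  qed
  have map_p: "map (p x) [0..<n] = u x n" if "x \<in> A" for x n
  proof (induction n)
    case 0
    then show ?case using length_u[OF that, of 0] by simp
  next
    case (Suc n)
    then show ?case using u_Suc[OF that, of n] by simp
  qed
  have wins: "infinite (digit_rounds (p x)) \<and> (x, digits (p x)) \<in> R" if x: "x \<in> A" for x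
  proof -
    have "position \<mu> \<tau> m (map (p x) [0..<n] @ [p x n])" for n
      using u_pos(1)[OF x, of "Suc n"] by (simp add: map_p[OF x] u_Suc[OF x])
    then have "follows_II \<tau> (p x)"
      unfolding follows_II_def using position_snocD(5) by blast
    moreover have "I_legal \<mu> 0 (p x) n" for n
      using u_pos(1)[OF x, of "Suc n"] m_pos m_less_1
      by (intro I_legal_of_position) (simp_all only: map_p[OF x])
    moreover have "bits (p x) = x"
    proof
      fix n
      have "bits_before (p x) (Suc n) = map x [0..<Suc n]"
        using u_pos(2)[OF x, of "Suc n"] by (simp only: pos_bits_map[symmetric] map_p[OF x])
      then show "bits (p x) n = x n"
        by (simp add: bits_before_def)
    qed
    ultimately show ?thesis
      using win[of "p x"] by (auto simp: II_wins_play_def)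
  qed
  have "continuous_on A (\<lambda>x. digits (p x))"
  proof (intro continuous_on_coordinatewise_then_product)
    fix i
    show "continuous_on A (\<lambda>x. digits (p x) i)"
      unfolding continuous_on_def
    proof (intro ballI tendsto_eventually)
      fix x assume x: "x \<in> A"
      \<comment> \<open>The \<open>i\<close>-th digit for \<open>x\<close> is played in round
        \<open>N\<close>, which is settled by the first \<open>Suc N\<close> bits. A point of
        \<open>A\<close> sharing these bits has the same rounds up to \<open>N\<close>, hence the
        same \<open>i\<close>-th digit.\<close>
      define N where "N = enumerate (digit_rounds (p x)) i"
      have "digits (p z) i = digits (p x) i" if z: "z \<in> A" "z \<in> cyl (map x [0..<Suc N])" for z
      proof -
        have "map z [0..<Suc N] = map x [0..<Suc N]"
          using z(2) mem_cyl_iff[of z "map x [0..<Suc N]"] by (simp del: upt_Suc)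
        then have "u z (Suc N) = u x (Suc N)"
          by (simp only: u_def)
        then have "map (p z) [0..<Suc N] = map (p x) [0..<Suc N]"
          using z x by (simp only: map_p)
        then have eq: "p z k = p x k" if "k \<le> N" for k
          using that by (auto simp del: upt_Suc)
        have S: "k \<in> digit_rounds (p z) \<longleftrightarrow> k \<in> digit_rounds (p x)" if "k \<le> N" for k
          using eq[OF that] by (simp add: digit_rounds_def)
        have N_in: "N \<in> digit_rounds (p x)"
          unfolding N_def using wins[OF x] by (intro enumerate_in_set) simp
        have "enumerate (digit_rounds (p z)) i = N"
        proof (rule enumerate_eqI)
          show "infinite (digit_rounds (p z))" using wins[OF z(1)] by simp
          show "N \<in> digit_rounds (p z)" using S[of N] N_in by simp
          have "{s \<in> digit_rounds (p z). s < N} = {s \<in> digit_rounds (p x). s < N}"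
            using S by auto
          also have "card \<dots> = i"
            unfolding N_def using wins[OF x] by (intro card_less_enumerate) simp
          finally show "card {s \<in> digit_rounds (p z). s < N} = i" .
        qed
        then show ?thesis
          using eq[of N] by (simp add: digits_def N_def)
      qed
      then show "\<forall>\<^sub>F z in at x within A. digits (p z) i = digits (p x) i"
        unfolding eventually_at_topological
        using open_cyl map_upt_mem_cyl by blast
    qed
  qed
  then show ?thesis
    using A wins by blast
qed

end

section \<open>Determinacy and the choice of I's total mass\<close>

theorem theorem5p7:
  fixes \<mu> :: "(nat \<Rightarrow> bool) measure"
    and R :: "((nat \<Rightarrow> bool) \<times> (nat \<Rightarrow> nat)) set"
  assumes "prob_space \<mu>"
    and "sets \<mu> = sets borel"
    and "{x. \<exists>y. (x, y) \<in> R} = UNIV"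
    and "unfolded_game_determined \<mu> 0 R"
  shows "\<forall>\<epsilon>>0. \<exists>A f. closed A \<and> measure \<mu> A > 1 - \<epsilon> \<and>
           continuous_on A (f :: (nat \<Rightarrow> bool) \<Rightarrow> (nat \<Rightarrow> nat)) \<and> (\<forall>x\<in>A. (x, f x) \<in> R)"
proof (intro allI impI)
  fix \<epsilon> :: real assume "0 < \<epsilon>"
  interpret cantor_prob \<mu>
    using assms(1,2) by (simp add: cantor_prob_def cantor_prob_axioms_def)
  have "\<exists>y. (x, y) \<in> R" for x
    using assms(3) by blast
  then have "\<exists>p. follows_I \<sigma> p \<and> II_wins_play \<mu> 0 R p" for \<sigma>
    by (rule I_has_no_winning_strategy)
  then obtain \<tau> where \<tau>: "\<And>p. follows_II \<tau> p \<Longrightarrow> II_wins_play \<mu> 0 R p"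
    using assms(4) unfolding unfolded_game_determined_def by blast
  \<comment> \<open>Half of \<open>\<epsilon>\<close> bounds I's total mass, the other half the loss
    in the tree; \<open>m < 1\<close> keeps the total mass admissible.\<close>
  have "0 < min 1 (\<epsilon> / 2)"
    using \<open>0 < \<epsilon>\<close> by simp
  then obtain m :: rat where m: "0 < real_of_rat m" "real_of_rat m < min 1 (\<epsilon> / 2)"
    using of_rat_dense by blast
  interpret II_winning \<mu> \<tau> R m
    using \<tau> m by unfold_locales simp_all
  obtain A f where "closed A" "1 - of_rat m - \<epsilon> / 2 \<le> prob A"
    "continuous_on A (f :: (nat \<Rightarrow> bool) \<Rightarrow> (nat \<Rightarrow> nat))" "\<forall>x\<in>A. (x, f x) \<in> R"
    using continuous_uniformization[of "\<epsilon> / 2"] \<open>0 < \<epsilon>\<close> by auto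
  moreover from this have "1 - \<epsilon> < prob A"
    using m(2) by simp
  ultimately show "\<exists>A f. closed A \<and> measure \<mu> A > 1 - \<epsilon> \<and>
      continuous_on A (f :: (nat \<Rightarrow> bool) \<Rightarrow> (nat \<Rightarrow> nat)) \<and> (\<forall>x\<in>A. (x, f x) \<in> R)"
    by blast
qed

end
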